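(* Let $k\ge 2$ and $d\ge 1$ be integers and let $0<\theta<1$ be a real number with $d\theta>1$. Let $N\ge 1$ and let $s_1\prec s_2\prec\cdots\prec s_N$ be elements of $\omega^{\not\downarrow\le k}$ with $|s_1|=\cdots=|s_N|<k$. Let $v\in\omega^{\not\downarrow k}$ with $s_N\prec v$, and suppose that $x\in\sum_{i=1}^N\oplus T^k[s_i]\subset T_k(d,\theta)$ satisfies $v<x$. If $x$ is decomposed as $x=x_1+\cdots+x_N$ with $x_i\in T^k[s_i]$, then $$\max_{1\le i\le N}\|x_i\|\ \le\ \|x\|\ \le\ \frac{\theta(d-1)}{1-\theta}\,\max_{1\le i\le N}\|x_i\| .$$ In particular, if $\|x_1\|=\cdots=\|x_N\|=1$, then $\mathrm{span}\{x_1,\dots,x_N\}$ is isomorphic to $\ell_\infty^N$ in the canonical way (the unit vector basis of $\ell_\infty^N$ corresponding to $x_1,\dots,x_N$), with isomorphism constant independent of $N$ and of the $x_i$'s.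
   Context: Sequences and orders. $\omega=\{0,1,2,\dots\}$. For an integer $k\ge1$, $\omega^{\not\downarrow\le k}$ is the set of all non-decreasing finite sequences of elements of $\omega$ of length at most $k$ (including the empty sequence $()$), and $\omega^{\not\downarrow k}$ is the set of those of length exactly $k$; $|s|$ is the length of $s$. Write $s\sqsubset t$ if $s$ is a proper initial segment of $t$, and $s\sqsubseteq t$ if $s\sqsubset t$ or $s=t$. Let $<_{\mathrm{lex}}$ be the lexicographic order in which a proper initial segment precedes the longer sequence. The well-order $\prec$ (of order type $\omega$) on $\omega^{\not\downarrow\le k}$ is: $()\prec s$ for all nonempty $s$; and for nonempty sequences, $(s_1,\dots,s_i)\prec(t_1,\dots,t_j)$ iff $s_i<t_j$, or $s_i=t_j$ and $(s_1,\dots,s_i)<_{\mathrm{lex}}(t_1,\dots,t_j)$. The spaces $\mathcal E_k$. An $\mathcal E_k$-tree is a function $\widehat X:\omega^{\not\downarrow\le k}\to\omega^{\not\downarrow\le k}$ preserving $\prec$ and $\sqsubset$ (hence preserving lengths). $\mathcal E_k$ is the collection of all sets $X=\widehat X[\omega^{\not\downarrow k}]$, for $\widehat X$ an $\mathcal E_k$-tree. For $X\in\mathcal E_k$ and $n\ge1$, $r_n(X)$ is the set of the $\prec$-least $n$ elements of $X$, and $\mathcal{AR}^k=\{r_n(X):X\in\mathcal E_k,\ n\ge1\}$. The Banach space $T_k(d,\theta)$. For nonempty finite $E,F\subset\omega^{\not\downarrow k}$, $E<F$ means $\max_\prec E\prec\min_\prec F$. Let $c_{00}(\omega^{\not\downarrow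 k})$ be the space of finitely supported functions $x:\omega^{\not\downarrow k}\to\mathbb R$, with canonical basis $(e_v)$, and $Ex=\sum_{v\in E}x_ve_v$. A sequence $(E_i)_{i=1}^m$ in $\mathcal{AR}^k$ is $d$-admissible if $m\le d$ and $E_1<\cdots<E_m$. Put $|x|_0=\max_v|x_v|$ and $|x|_{j+1}=\max\{|x|_j,\ \theta\max\{\sum_{i=1}^m|E_ix|_j:1\le m\le d,\ (E_i)_{i=1}^m\ d\text{-admissible}\}\}$, and $\|x\|=\sup_j|x|_j$. $T_k(d,\theta)$ is the completion of $c_{00}(\omega^{\not\downarrow k})$ in this norm; $(e_v)$ is a 1-unconditional basis of it. For $x\in T_k(d,\theta)$, $\mathrm{supp}(x)$ is the set of $v$ with nonzero coordinate, and $v<x$ means $v\prec w$ for all $w\in\mathrm{supp}(x)$. Tree subspaces. For $s\in\omega^{\not\downarrow\le k}$, $\tau^k[s]=\{v\in\omega^{\not\downarrow k}:s\sqsubseteq v\}$ and $T^k[s]$ is the closed linear span of $\{e_v:v\in\tau^k[s]\}$ in $T_k(d,\theta)$. *)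

theory Defs
  imports "HOL-Analysis.Analysis" "HOL-Library.Sublist"
begin

section \<open>Non-decreasing sequences and the well-order\<close>

definition nd_le :: "nat \<Rightarrow> nat list set" where
  "nd_le k = {s. sorted s \<and> length s \<le> k}"

definition nd_eq :: "nat \<Rightarrow> nat list set" where
  "nd_eq k = {s. sorted s \<and> length s = k}"

text \<open>In \<^const>\<open>lexord\<close> a proper initial segment precedes the longer list.
  Note that \<^term>\<open>last\<close> is compared first.\<close>

definition tprec :: "nat list \<Rightarrow> nat list \<Rightarrow> bool" (infix \<open>\<lhd>\<close> 50) where
  "s \<lhd> t \<longleftrightarrow>
     (s = [] \<and> t \<noteq> []) \<or>
     (s \<noteq> [] \<and> t \<noteq> [] \<and>
       (last s < last t \<or> last s = last t \<and> (s, t) \<in> lexord {(a, b). a < b}))"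


section \<open>The spaces $\mathcal{E}_k$ and their finite approximations\<close>

definition E_tree :: "nat \<Rightarrow> (nat list \<Rightarrow> nat list) \<Rightarrow> bool" where
  "E_tree k f \<longleftrightarrow>
     f ` nd_le k \<subseteq> nd_le k \<and>
     (\<forall>s\<in>nd_le k. \<forall>t\<in>nd_le k. s \<lhd> t \<longrightarrow> f s \<lhd> f t) \<and>
     (\<forall>s\<in>nd_le k. \<forall>t\<in>nd_le k. strict_prefix s t \<longrightarrow> strict_prefix (f s) (f t))"

definition E_space :: "nat \<Rightarrow> nat list set set" where
  "E_space k = {f ` nd_eq k | f. E_tree k f}"

text \<open>The \<open>n\<close> least elements of \<open>X\<close>: those with fewer than \<open>n\<close> predecessors in \<open>X\<close>.
  The order has type \<open>\<omega>\<close> on \<^term>\<open>nd_le k\<close>, so only cardinalities of finite sets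
  are taken when \<^prop>\<open>X \<subseteq> nd_eq k\<close>.\<close>

definition approx :: "nat \<Rightarrow> nat list set \<Rightarrow> nat list set" where
  "approx n X = {v \<in> X. card {w \<in> X. w \<lhd> v} < n}"

definition AR_fin :: "nat \<Rightarrow> nat list set set" where
  "AR_fin k = {approx n X | n X. X \<in> E_space k \<and> n \<ge> 1}"


section \<open>The norm on finitely supported functions\<close>

text \<open>For nonempty finite sets this is \<open>max E \<lhd> min F\<close>.\<close>

definition block_less :: "nat list set \<Rightarrow> nat list set \<Rightarrow> bool" where
  "block_less E F \<longleftrightarrow> (\<forall>v\<in>E. \<forall>w\<in>F. v \<lhd> w)"

definition admissible :: "nat \<Rightarrow> nat \<Rightarrow> nat list set list \<Rightarrow> bool" where
  "admissible k d Es \<longleftrightarrow>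
     1 \<le> length Es \<and> length Es \<le> d \<and> set Es \<subseteq> AR_fin k \<and> sorted_wrt block_less Es"

definition c00 :: "nat \<Rightarrow> (nat list \<Rightarrow> real) set" where
  "c00 k = {x. finite {v. x v \<noteq> 0} \<and> {v. x v \<noteq> 0} \<subseteq> nd_eq k}"

definition restr :: "nat list set \<Rightarrow> (nat list \<Rightarrow> real) \<Rightarrow> nat list \<Rightarrow> real" where
  "restr E x = (\<lambda>v. if v \<in> E then x v else 0)"

text \<open>For \<^prop>\<open>x \<in> c00 k\<close> both maxima below are over finite sets of reals, since a restriction
  of \<open>x\<close> is determined by a subset of the finite support of \<open>x\<close>.\<close>

fun pre_norm :: "nat \<Rightarrow> nat \<Rightarrow> real \<Rightarrow> nat \<Rightarrow> (nat list \<Rightarrow> real) \<Rightarrow> real" where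
  "pre_norm k d \<theta> 0 x = Max ((\<lambda>v. \<bar>x v\<bar>) ` nd_eq k)"
| "pre_norm k d \<theta> (Suc j) x =
     max (pre_norm k d \<theta> j x)
         (\<theta> * Max {\<Sum>E\<leftarrow>Es. pre_norm k d \<theta> j (restr E x) | Es. admissible k d Es})"

definition T_norm :: "nat \<Rightarrow> nat \<Rightarrow> real \<Rightarrow> (nat list \<Rightarrow> real) \<Rightarrow> real" where
  "T_norm k d \<theta> x = (SUP j. pre_norm k d \<theta> j x)"


section \<open>The completion, supports and tree subspaces\<close>

text \<open>The map \<open>x \<mapsto> (\<Sum>v. x v *\<^sub>R e v)\<close> embeds \<^term>\<open>c00 k\<close> with the norm \<^const>\<open>T_norm\<close>
  isometrically into a Banach space. Its closed range \<^term>\<open>T_space k e\<close> is then the completion of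
  \<^term>\<open>c00 k\<close>, which is unique up to isometric isomorphism, and the vectors
  \<open>e v\<close>, for \<open>v\<close> in \<^term>\<open>nd_eq k\<close>, are its canonical basis. (Since the space depends on the values
  \<open>k\<close>, \<open>d\<close>, \<open>\<theta>\<close>, it is not a type of its own.)\<close>

definition T_basis :: "nat \<Rightarrow> nat \<Rightarrow> real \<Rightarrow> (nat list \<Rightarrow> 'b::banach) \<Rightarrow> bool" where
  "T_basis k d \<theta> e \<longleftrightarrow>
     (\<forall>x\<in>c00 k. norm (\<Sum>v | x v \<noteq> 0. x v *\<^sub>R e v) = T_norm k d \<theta> x)"

definition T_space :: "nat \<Rightarrow> (nat list \<Rightarrow> 'b::banach) \<Rightarrow> 'b set" where
  "T_space k e = closure (span (e ` nd_eq k))"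

text \<open>The coordinates with respect to the (unconditional) basis \<open>e\<close>.\<close>

definition coords :: "nat \<Rightarrow> (nat list \<Rightarrow> 'b::banach) \<Rightarrow> 'b \<Rightarrow> nat list \<Rightarrow> real" where
  "coords k e x =
     (THE c. (\<forall>v. v \<notin> nd_eq k \<longrightarrow> c v = 0) \<and> ((\<lambda>v. c v *\<^sub>R e v) has_sum x) (nd_eq k))"

definition supp :: "nat \<Rightarrow> (nat list \<Rightarrow> 'b::banach) \<Rightarrow> 'b \<Rightarrow> nat list set" where
  "supp k e x = {v. coords k e x v \<noteq> 0}"

definition subtree :: "nat \<Rightarrow> nat list \<Rightarrow> nat list set" where
  "subtree k s = {v \<in> nd_eq k. prefix s v}"

definition T_sub :: "nat \<Rightarrow> (nat list \<Rightarrow> 'b::banach) \<Rightarrow> nat list \<Rightarrow> 'b set" where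
  "T_sub k e s = closure (span (e ` subtree k s))"


section \<open>Canonical isomorphism with $\ell_\infty^N$\<close>

definition linf :: "nat \<Rightarrow> (nat \<Rightarrow> real) set" where
  "linf N = {a. \<forall>i. i \<notin> {1..N} \<longrightarrow> a i = 0}"

definition linf_norm :: "nat \<Rightarrow> (nat \<Rightarrow> real) \<Rightarrow> real" where
  "linf_norm N a = (MAX i\<in>{1..N}. \<bar>a i\<bar>)"

text \<open>The linear map sending the unit vector basis to \<open>y 1, \<dots>, y N\<close> is an isomorphism \<open>J\<close>
  of $\ell_\infty^N$ onto the span, with \<open>\<parallel>J\<parallel> \<cdot> \<parallel>J\<inverse>\<parallel> \<le> C\<close>
  (take \<open>\<parallel>J\<parallel> \<le> B\<close> and \<open>\<parallel>J\<inverse>\<parallel> \<le> 1 / A\<close>).\<close>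

definition canonically_linf :: "real \<Rightarrow> nat \<Rightarrow> (nat \<Rightarrow> 'b::real_normed_vector) \<Rightarrow> bool" where
  "canonically_linf C N y \<longleftrightarrow>
     bij_betw (\<lambda>a. \<Sum>i=1..N. a i *\<^sub>R y i) (linf N) (span (y ` {1..N})) \<and>
     (\<exists>A B. 0 < A \<and> 0 < B \<and> B / A \<le> C \<and>
        (\<forall>a\<in>linf N. A * linf_norm N a \<le> norm (\<Sum>i=1..N. a i *\<^sub>R y i) \<and>
                    norm (\<Sum>i=1..N. a i *\<^sub>R y i) \<le> B * linf_norm N a))"

end

theory Submission
  imports Defs
begin

text \<open>A set \<open>E \<in> \<A>\<R>\<^sup>k\<close> with \<open>v \<lhd> E\<close> meets at most one of the subtrees
  \<open>\<tau>\<^sup>k[s\<^sub>i]\<close>, because all \<open>s\<^sub>i\<close> have the same length and precede \<open>v\<close>. Hence in an admissible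
  sequence all sets but the first one meeting the support of \<open>x\<close> contribute at most
  \<open>M = max \<parallel>x\<^sub>i\<parallel>\<close>. The first one contributes at most \<open>B\<close>, by induction on the level of the norm, where
  \<open>B = \<theta>(d - 1)M / (1 - \<theta>)\<close> is the fixed point of \<open>B = \<theta>(B + (d - 1)M)\<close>. The lower bound is
  unconditionality of the basis, and the general case follows by passing to the limit
  along finite sections.\<close>

section \<open>Sequences and trees\<close>

lemma tprec_irrefl: "\<not> s \<lhd> s"
  using lexord_irreflexive[of "{(a, b). a < b}" s] by (auto simp: tprec_def)

lemma tprec_trans:
  assumes "s \<lhd> t" "t \<lhd> u"
  shows "s \<lhd> u"
proof -
  have "trans {(a, b::nat). a < b}"
    by (auto simp: trans_def)
  then show ?thesis
    using assms lexord_trans unfolding tprec_def by (metis order.strict_trans)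
qed

text \<open>The last entry of a sorted list is its largest, so it is positive unless all entries
  vanish. As \<open>\<lhd>\<close> compares last entries first, lengths do not matter:
  \<open>k\<close> need not be \<open>length q\<close>.\<close>

lemma zeros_tprec:
  assumes "sorted q" "q \<noteq> replicate (length q) 0" "k > 0"
  shows "replicate k 0 \<lhd> q"
proof -
  obtain a where a: "a \<in> set q" "a \<noteq> 0"
    using assms(2) replicate_length_same[of q 0] by metis
  then obtain r b where q: "q = r @ [b]"
    by (cases q rule: rev_cases) auto
  have "a \<le> last q"
    using assms(1) a(1) by (auto simp: q sorted_append)
  then show ?thesis
    using q a(2) assms(3) by (auto simp: tprec_def)
qed

text \<open>Along the initial segments of \<open>t\<close> the lengths of the images increase
  strictly. They start at 0 or more and are at most \<open>k\<close> after \<open>k\<close> steps,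
  which leaves no slack at any level.\<close>

lemma E_tree_length:
  assumes f: "E_tree k f" and t: "t \<in> nd_eq k" and "j \<le> k"
  shows "length (f (take j t)) = j"
proof -
  have nd: "take i t \<in> nd_le k" for i
    using t by (auto simp: nd_le_def nd_eq_def sorted_wrt_take)
  have step: "length (f (take i t)) < length (f (take (Suc i) t))" if "i < k" for i
  proof -
    have "take (Suc i) t = take i t @ [t ! i]"
      using t that by (simp add: nd_eq_def take_Suc_conv_app_nth)
    then have "strict_prefix (take i t) (take (Suc i) t)"
      by (simp add: strict_prefix_def)
    then show ?thesis
      using f nd unfolding E_tree_def by (metis prefix_length_less)
  qed
  have le: "j \<le> k \<Longrightarrow> length (f (take 0 t)) + j \<le> length (f (take j t))" for j
  proof (induction j)
    case (Suc j)
    then show ?case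
      using step[of j] by simp
  qed simp
  \<comment> \<open>The same count taken downwards from level \<open>k\<close>; together with
    \<open>le\<close> it pins the length at level \<open>j\<close> from both sides.\<close>
  have ge: "n \<le> k \<Longrightarrow> length (f (take (k - n) t)) + n \<le> length (f (take k t))" for n
  proof (induction n)
    case (Suc n)
    then show ?case
      using step[of "k - Suc n"] by (simp add: Suc_diff_Suc)
  qed simp
  have "length (f (take k t)) \<le> k"
    using f nd unfolding E_tree_def nd_le_def by blast
  then show ?thesis
    using le[OF \<open>j \<le> k\<close>] ge[of "k - j"] \<open>j \<le> k\<close> by simp
qed

text \<open>The least element of \<open>E\<close> is \<open>f (0, \<dots>, 0)\<close>, and it precedes \<open>f p\<close> for every \<open>p\<close> of length \<open>l\<close>
  other than \<open>(0, \<dots>, 0)\<close>. So at most one node of level \<open>l\<close> below an element of \<open>E\<close>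
  precedes \<open>min E\<close>.\<close>
lemma AR_fin_single_subtree:
  assumes k: "k > 0" and E: "E \<in> AR_fin k"
    and v: "\<And>w. w \<in> E \<Longrightarrow> v \<lhd> w"
    and s: "s \<lhd> v" "s' \<lhd> v" "length s = length s'"
    and w: "w \<in> E" "prefix s w" "w' \<in> E" "prefix s' w'"
  shows "s = s'"
proof (rule ccontr)
  assume ne: "s \<noteq> s'"
  obtain n f where f: "E_tree k f" and n: "n \<ge> 1" and En: "E = approx n (f ` nd_eq k)"
    using E by (auto simp: AR_fin_def E_space_def)
  define z where "z = replicate k (0::nat)"
  have z: "z \<in> nd_eq k"
    by (simp add: z_def nd_eq_def)
  have nd: "nd_eq k \<subseteq> nd_le k"
    by (auto simp: nd_eq_def nd_le_def)
  have mono: "f a \<lhd> f b" if "a \<in> nd_le k" "b \<in> nd_le k" "a \<lhd> b" for a b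
    using f that by (auto simp: E_tree_def)
  have z_least: "z \<lhd> q" if "q \<in> nd_le k" "q \<noteq> replicate (length q) 0" for q
    using zeros_tprec that k by (simp add: z_def nd_le_def)
  \<comment> \<open>Hence \<open>f z\<close> has no predecessor in the image of \<open>f\<close>,
    and \<open>n \<ge> 1\<close> puts it into \<open>E\<close>.\<close>
  have "\<not> f q \<lhd> f z" if "q \<in> nd_eq k" for q
  proof (cases "q = z")
    case True
    then show ?thesis by (simp add: tprec_irrefl)
  next
    case False
    then have "q \<noteq> replicate (length q) 0"
      using that by (simp add: nd_eq_def z_def)
    then have "f z \<lhd> f q"
      using mono z_least z nd that by blast
    then show ?thesis
      using tprec_trans tprec_irrefl by blast
  qed
  then have "{w \<in> f ` nd_eq k. w \<lhd> f z} = {}"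
    by auto
  then have "card {w \<in> f ` nd_eq k. w \<lhd> f z} = 0"
    by (metis card.empty)
  then have "f z \<in> E"
    using n z by (simp add: En approx_def)
  then have vz: "v \<lhd> f z"
    by (rule v)
  \<comment> \<open>If \<open>u = f t\<close>, the initial segment of \<open>t\<close> of length
    \<open>length r\<close> is sent to an initial segment of \<open>u\<close> of that same length,
    which must be \<open>r\<close>.\<close>
  have node: "\<exists>p \<in> nd_le k. length p = length r \<and> f p = r"
    if u: "u \<in> E" "prefix r u" for u r
  proof -
    obtain t where t: "t \<in> nd_eq k" "u = f t"
      using u(1) by (auto simp: En approx_def)
    have lt: "length t = k" "length (f t) = k"
      using E_tree_length[OF f t(1), of k] t(1) by (auto simp: nd_eq_def)
    then have lr: "length r \<le> k"
      using u(2) t(2) prefix_length_le by metis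
    let ?p = "take (length r) t"
    have p: "?p \<in> nd_le k" "length ?p = length r"
      using t(1) lr by (auto simp: nd_le_def nd_eq_def sorted_wrt_take)
    have "length (f ?p) = length r"
      using E_tree_length[OF f t(1)] lr by simp
    moreover have "prefix (f ?p) (f t)"
    proof (cases "length r = k")
      case False
      then have "strict_prefix ?p t"
        using lr lt by (auto simp: strict_prefix_def take_is_prefix)
      then show ?thesis
        using f p(1) t(1) nd unfolding E_tree_def by (auto simp: strict_prefix_def)
    qed (simp add: lt)
    ultimately have "f ?p = r"
      using u(2) t(2) by (metis prefix_length_prefix prefix_order.antisym order_refl)
    then show ?thesis
      using p by blast
  qed
  obtain p where p: "p \<in> nd_le k" "length p = length s" "f p = s"
    using node w by blast
  obtain p' where p': "p' \<in> nd_le k" "length p' = length s'" "f p' = s'"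
    using node w by blast
  \<comment> \<open>Two distinct nodes of one level cannot both be images of the zero sequence of
    that level.\<close>
  have "p \<noteq> replicate (length p) 0 \<or> p' \<noteq> replicate (length p') 0"
    using ne p p' s(3) by metis
  then have "f z \<lhd> s \<or> f z \<lhd> s'"
    using mono z_least z nd p p' by (metis subsetD)
  then show False
    using vz s(1,2) tprec_trans tprec_irrefl by metis
qed


section \<open>The norm on finitely supported functions\<close>

lemma restr_c00: "x \<in> c00 k \<Longrightarrow> restr E x \<in> c00 k"
  unfolding c00_def restr_def by (auto elim: rev_finite_subset)

lemma restr_restr: "restr E (restr F x) = restr (E \<inter> F) x"
  by (auto simp: restr_def)

lemma zero_c00: "(\<lambda>_. 0) \<in> c00 k"
  by (simp add: c00_def)

lemma id_E_tree: "E_tree k id"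
  by (simp add: E_tree_def)

locale tree_norm =
  fixes k d :: nat and \<theta> :: real
  assumes k_pos: "k > 0" and d_pos: "d > 0" and \<theta>_pos: "0 < \<theta>" and \<theta>_less: "\<theta> < 1"
begin

abbreviation "P \<equiv> pre_norm k d \<theta>"

text \<open>Ensures that the inner maximum of \<open>pre_norm\<close> is over a nonempty set; the
  witness is a one-term sequence coming from the identity tree.\<close>

lemma admissible_exists: "\<exists>Es. admissible k d Es"
proof -
  have "approx 1 (id ` nd_eq k) \<in> AR_fin k"
    unfolding AR_fin_def E_space_def using id_E_tree by blast
  then have "admissible k d [approx 1 (id ` nd_eq k)]"
    using d_pos by (simp add: admissible_def)
  then show ?thesis ..
qed

text \<open>Each sum depends only on a list of at most \<open>d\<close> restrictions of
  \<open>x\<close>, and a restriction is determined by a subset of the finite support.\<close>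

lemma finite_admissible_sums:
  assumes "x \<in> c00 k"
  shows "finite {\<Sum>E\<leftarrow>Es. P j (restr E x) | Es. admissible k d Es}"
proof -
  let ?R = "(\<lambda>A. restr A x) ` Pow {v. x v \<noteq> 0}"
  have "restr E x \<in> ?R" for E
  proof
    show "restr E x = restr (E \<inter> {v. x v \<noteq> 0}) x"
      by (auto simp: restr_def)
  qed auto
  then have "{map (\<lambda>E. restr E x) Es | Es. admissible k d Es} \<subseteq> {ys. set ys \<subseteq> ?R \<and> length ys \<le> d}"
    by (auto simp: admissible_def)
  moreover have "finite ?R"
    using assms by (simp add: c00_def)
  ultimately have "finite {map (\<lambda>E. restr E x) Es | Es. admissible k d Es}"
    using finite_lists_length_le finite_subset by blast
  then have "finite ((\<lambda>ys. \<Sum>y\<leftarrow>ys. P j y) ` {map (\<lambda>E. restr E x) Es | Es. admissible k d Es})"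
    by (rule finite_imageI)
  then show ?thesis
    by (rule rev_finite_subset) (force simp: comp_def)
qed

lemma pre_norm_0_le_iff:
  assumes "x \<in> c00 k"
  shows "P 0 x \<le> B \<longleftrightarrow> (\<forall>v\<in>nd_eq k. \<bar>x v\<bar> \<le> B)"
proof -
  have "(\<lambda>v. \<bar>x v\<bar>) ` nd_eq k \<subseteq> insert 0 ((\<lambda>v. \<bar>x v\<bar>) ` {v. x v \<noteq> 0})"
    by force
  then have "finite ((\<lambda>v. \<bar>x v\<bar>) ` nd_eq k)"
    by (rule finite_subset) (use assms in \<open>simp add: c00_def\<close>)
  moreover have "replicate k 0 \<in> nd_eq k"
    by (simp add: nd_eq_def)
  ultimately show ?thesis
    by (subst pre_norm.simps, subst Max_le_iff) auto
qed

text \<open>Reading the recursion through its upper bounds removes \<open>Max\<close> from the later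
  inductions. Taking \<open>B\<close> to be the norm itself gives the basic inequalities.\<close>

lemma pre_norm_Suc_le_iff:
  assumes "x \<in> c00 k"
  shows "P (Suc j) x \<le> B \<longleftrightarrow>
    P j x \<le> B \<and> (\<forall>Es. admissible k d Es \<longrightarrow> \<theta> * (\<Sum>E\<leftarrow>Es. P j (restr E x)) \<le> B)"
proof -
  let ?A = "{\<Sum>E\<leftarrow>Es. P j (restr E x) | Es. admissible k d Es}"
  have "\<theta> * Max ?A \<le> B \<longleftrightarrow> Max ?A \<le> B / \<theta>"
    using \<theta>_pos by (simp add: field_simps)
  also have "\<dots> \<longleftrightarrow> (\<forall>a\<in>?A. a \<le> B / \<theta>)"
    using finite_admissible_sums[OF assms] admissible_exists by (intro Max_le_iff) auto
  also have "\<dots> \<longleftrightarrow> (\<forall>Es. admissible k d Es \<longrightarrow> \<theta> * (\<Sum>E\<leftarrow>Es. P j (restr E x)) \<le> B)"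
    using \<theta>_pos by (auto simp: field_simps)
  finally show ?thesis
    by simp
qed

lemma abs_le_pre_norm:
  assumes "x \<in> c00 k"
  shows "\<bar>x v\<bar> \<le> P j x"
proof (induction j)
  case 0
  have "replicate k 0 \<in> nd_eq k"
    by (simp add: nd_eq_def)
  \<comment> \<open>The maximum at level 0 sees only \<open>nd_eq k\<close>; elsewhere
    \<open>x\<close> vanishes and nonnegativity gives the bound.\<close>
  then have "0 \<le> P 0 x"
    using pre_norm_0_le_iff[OF assms, of "P 0 x"] abs_ge_zero order_trans by blast
  then show ?case
    using pre_norm_0_le_iff[OF assms, of "P 0 x"] assms by (cases "x v = 0") (auto simp: c00_def)
next
  case (Suc j)
  then show ?case
    using pre_norm_Suc_le_iff[OF assms, of j "P (Suc j) x"] by linarith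
qed

lemma pre_norm_nonneg: "x \<in> c00 k \<Longrightarrow> 0 \<le> P j x"
  using abs_le_pre_norm abs_ge_zero order_trans by blast

text \<open>Restrictions commute, so the induction hypothesis for \<open>restr E x\<close> compares
  the two admissible sums term by term.\<close>

lemma pre_norm_restr_le: "x \<in> c00 k \<Longrightarrow> P j (restr F x) \<le> P j x"
proof (induction j arbitrary: x)
  case 0
  have "\<bar>restr F x v\<bar> \<le> P 0 x" for v
    using abs_le_pre_norm[OF 0, of v 0] by (auto simp: restr_def)
  then show ?case
    using pre_norm_0_le_iff[OF restr_c00[OF 0]] by blast
next
  case (Suc j)
  have "\<theta> * (\<Sum>E\<leftarrow>Es. P j (restr E (restr F x))) \<le> P (Suc j) x" if "admissible k d Es" for Es
  proof -
    have "P j (restr E (restr F x)) \<le> P j (restr E x)" for E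
      using Suc.IH[OF restr_c00[OF Suc.prems], of E] by (simp add: restr_restr Int_commute)
    then have "\<theta> * (\<Sum>E\<leftarrow>Es. P j (restr E (restr F x))) \<le> \<theta> * (\<Sum>E\<leftarrow>Es. P j (restr E x))"
      using \<theta>_pos by (intro mult_left_mono sum_list_mono) auto
    also have "\<dots> \<le> P (Suc j) x"
      using pre_norm_Suc_le_iff[OF Suc.prems, of j "P (Suc j) x"] that by blast
    finally show ?thesis .
  qed
  moreover have "P j (restr F x) \<le> P (Suc j) x"
    using Suc.IH[OF Suc.prems] by simp
  ultimately show ?case
    using pre_norm_Suc_le_iff[OF restr_c00[OF Suc.prems]] by blast
qed

text \<open>Successive blocks are disjoint because \<open>\<lhd>\<close> is irreflexive, so no
  element of \<open>A\<close> is counted twice.\<close>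

lemma sum_list_block_le:
  fixes g :: "nat list \<Rightarrow> real"
  assumes "finite A" "\<And>v. 0 \<le> g v" "sorted_wrt block_less Es"
  shows "(\<Sum>E\<leftarrow>Es. sum g (A \<inter> E)) \<le> sum g (A \<inter> \<Union>(set Es))"
  using assms(3)
proof (induction Es)
  case (Cons E Es)
  have "E \<inter> \<Union>(set Es) = {}"
    using Cons.prems tprec_irrefl by (fastforce simp: block_less_def)
  then have "sum g (A \<inter> \<Union>(set (E # Es))) = sum g (A \<inter> E) + sum g (A \<inter> \<Union>(set Es))"
    using assms(1) by (subst sum.union_disjoint[symmetric]) (auto simp: Int_Un_distrib)
  then show ?case
    using Cons by simp
qed simp

text \<open>The \<open>\<ell>\<^sub>1\<close> norm of \<open>x\<close> bounds all \<open>P j x\<close>, so the supremum in \<^const>\<open>T_norm\<close> is a genuine one.\<close>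
lemma pre_norm_le_l1: "x \<in> c00 k \<Longrightarrow> P j x \<le> (\<Sum>v | x v \<noteq> 0. \<bar>x v\<bar>)"
proof (induction j arbitrary: x)
  case 0
  then have fin: "finite {v. x v \<noteq> 0}"
    by (simp add: c00_def)
  have "\<bar>x v\<bar> \<le> (\<Sum>v | x v \<noteq> 0. \<bar>x v\<bar>)" for v
    using member_le_sum[of v "{v. x v \<noteq> 0}" "\<lambda>v. \<bar>x v\<bar>"] fin
    by (cases "x v = 0") (auto simp: sum_nonneg)
  then show ?case
    using pre_norm_0_le_iff[OF 0] by blast
next
  case (Suc j)
  let ?A = "{v. x v \<noteq> 0}"
  have fin: "finite ?A"
    using Suc.prems by (simp add: c00_def)
  have "\<theta> * (\<Sum>E\<leftarrow>Es. P j (restr E x)) \<le> (\<Sum>v\<in>?A. \<bar>x v\<bar>)" if "admissible k d Es" for Es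
  proof -
    have "P j (restr E x) \<le> (\<Sum>v\<in>?A \<inter> E. \<bar>x v\<bar>)" for E
    proof -
      have "P j (restr E x) \<le> (\<Sum>v | restr E x v \<noteq> 0. \<bar>restr E x v\<bar>)"
        using Suc.IH[OF restr_c00[OF Suc.prems]] .
      also have "\<dots> = (\<Sum>v\<in>?A \<inter> E. \<bar>x v\<bar>)"
        by (rule sum.cong) (auto simp: restr_def)
      finally show ?thesis .
    qed
    then have "(\<Sum>E\<leftarrow>Es. P j (restr E x)) \<le> (\<Sum>E\<leftarrow>Es. \<Sum>v\<in>?A \<inter> E. \<bar>x v\<bar>)"
      by (intro sum_list_mono) auto
    also have "\<dots> \<le> (\<Sum>v\<in>?A \<inter> \<Union>(set Es). \<bar>x v\<bar>)"
      using that fin by (intro sum_list_block_le) (auto simp: admissible_def)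
    also have "\<dots> \<le> (\<Sum>v\<in>?A. \<bar>x v\<bar>)"
      using fin by (intro sum_mono2) auto
    finally have "(\<Sum>E\<leftarrow>Es. P j (restr E x)) \<le> (\<Sum>v\<in>?A. \<bar>x v\<bar>)" .
    moreover have "0 \<le> (\<Sum>E\<leftarrow>Es. P j (restr E x))"
      using pre_norm_nonneg[OF restr_c00[OF Suc.prems]] by (intro sum_list_nonneg) auto
    ultimately show ?thesis
      using \<theta>_less \<theta>_pos by (meson less_imp_le mult_left_le_one_le order_trans)
  qed
  then show ?case
    using pre_norm_Suc_le_iff[OF Suc.prems] Suc.IH[OF Suc.prems] by blast
qed

lemma pre_norm_le_T_norm:
  assumes "x \<in> c00 k"
  shows "P j x \<le> T_norm k d \<theta> x"
  unfolding T_norm_def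
  by (rule cSUP_upper, simp, rule bdd_aboveI2, rule pre_norm_le_l1[OF assms])

lemma T_norm_le: "(\<And>j. P j x \<le> B) \<Longrightarrow> T_norm k d \<theta> x \<le> B"
  unfolding T_norm_def by (rule cSUP_least) auto

lemma T_norm_restr_le: "x \<in> c00 k \<Longrightarrow> T_norm k d \<theta> (restr F x) \<le> T_norm k d \<theta> x"
  by (rule T_norm_le) (meson pre_norm_restr_le pre_norm_le_T_norm order_trans)

lemma abs_le_T_norm: "x \<in> c00 k \<Longrightarrow> \<bar>x v\<bar> \<le> T_norm k d \<theta> x"
  by (meson abs_le_pre_norm pre_norm_le_T_norm order_trans)

lemma pre_norm_zero: "P j (\<lambda>_. 0) = 0"
  using pre_norm_le_l1[OF zero_c00, of j] pre_norm_nonneg[OF zero_c00, of j] by simp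

section \<open>Upper estimates for vectors supported on subtrees of one level\<close>

text \<open>By \<open>AR_fin_single_subtree\<close> all points of the support inside
  \<open>E\<close> lie in one subtree, so \<open>restr E x\<close> is a restriction of a single
  component of \<open>x\<close>.\<close>

lemma pre_norm_single_subtree:
  assumes x: "x \<in> c00 k"
    and S: "\<And>s. s \<in> S \<Longrightarrow> s \<lhd> v \<and> length s = l \<and> T_norm k d \<theta> (restr (subtree k s) x) \<le> M"
    and supp: "\<And>w. x w \<noteq> 0 \<Longrightarrow> \<exists>s\<in>S. w \<in> subtree k s"
    and E: "E \<in> AR_fin k" "\<And>w. w \<in> E \<Longrightarrow> v \<lhd> w" and M: "0 \<le> M"
  shows "P j (restr E x) \<le> M"
proof (cases "\<exists>w\<in>E. x w \<noteq> 0")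
  case True
  then obtain w s where w: "w \<in> E" "s \<in> S" "w \<in> subtree k s"
    using supp by blast
  have "w' \<in> subtree k s" if w': "w' \<in> E" "x w' \<noteq> 0" for w'
  proof -
    obtain s' where s': "s' \<in> S" "w' \<in> subtree k s'"
      using supp w' by blast
    have "s = s'"
      by (rule AR_fin_single_subtree[OF k_pos E, where w = w and w' = w'])
        (use S w s' w' in \<open>auto simp: subtree_def\<close>)
    then show ?thesis
      using s' by simp
  qed
  then have "restr E x = restr E (restr (subtree k s) x)"
    by (fastforce simp: restr_def)
  then have "P j (restr E x) \<le> T_norm k d \<theta> (restr (subtree k s) x)"
    by (metis pre_norm_restr_le pre_norm_le_T_norm restr_c00 x order_trans)
  then show ?thesis
    using S[OF w(2)] by linarith
next
  case False
  then have "restr E x = (\<lambda>_. 0)"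
    by (auto simp: restr_def)
  then show ?thesis
    using M by (simp add: pre_norm_zero)
qed

text \<open>Only the first \<open>E\<close> that meets the support of \<open>x\<close> can meet more than one subtree.\<close>
lemma sum_list_pre_norm_le:
  assumes x: "x \<in> c00 k"
    and S: "\<And>s. s \<in> S \<Longrightarrow> s \<lhd> v \<and> length s = l \<and> T_norm k d \<theta> (restr (subtree k s) x) \<le> M"
    and supp: "\<And>w. x w \<noteq> 0 \<Longrightarrow> v \<lhd> w \<and> (\<exists>s\<in>S. w \<in> subtree k s)"
    and M: "0 \<le> M" and B: "\<And>E. P j (restr E x) \<le> B"
    and Es: "Es \<noteq> []" "set Es \<subseteq> AR_fin k" "sorted_wrt block_less Es"
  shows "(\<Sum>E\<leftarrow>Es. P j (restr E x)) \<le> B + (real (length Es) - 1) * M"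
  using Es
proof (induction Es)
  case (Cons E Es)
  show ?case
  proof (cases "\<exists>u\<in>E. x u \<noteq> 0")
    case True
    then obtain u where u: "u \<in> E" "v \<lhd> u"
      using supp by blast
    have "P j (restr F x) \<le> M" if "F \<in> set Es" for F
    proof (rule pre_norm_single_subtree[OF x S _ _ _ M])
      show "F \<in> AR_fin k"
        using that Cons.prems by auto
      show "v \<lhd> w" if "w \<in> F" for w
        using \<open>F \<in> set Es\<close> that u Cons.prems tprec_trans by (auto simp: block_less_def)
    qed (use supp in auto)
    then have "(\<Sum>F\<leftarrow>Es. P j (restr F x)) \<le> (\<Sum>F\<leftarrow>Es. M)"
      by (intro sum_list_mono) auto
    then show ?thesis
      using B[of E] by (simp add: sum_list_triv)
  next
    case False
    then have "restr E x = (\<lambda>_. 0)"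
      by (auto simp: restr_def)
    then have E0: "P j (restr E x) = 0"
      by (simp add: pre_norm_zero)
    \<comment> \<open>An empty tail is treated apart, since the bound is proved for nonempty lists
      only. Otherwise the skipped block contributes 0, and the bound grows by
      \<open>M \<ge> 0\<close>.\<close>
    show ?thesis
    proof (cases "Es = []")
      case True
      then show ?thesis
        using B[of E] by simp
    next
      case False
      then have "(\<Sum>E\<leftarrow>Es. P j (restr E x)) \<le> B + (real (length Es) - 1) * M"
        using Cons by auto
      then show ?thesis
        using E0 M by (simp add: algebra_simps)
    qed
  qed
qed simp

text \<open>The upper estimate for finitely supported vectors. One bound \<open>B\<close> serves all
  levels \<open>j\<close>: an admissible sum costs at most one \<open>B\<close> and
  \<open>d - 1\<close> times \<open>M\<close>, and the factor \<open>\<theta>\<close> brings this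
  back to \<open>B\<close>.\<close>

lemma T_norm_tree_sum_le:
  assumes d\<theta>: "real d * \<theta> > 1" and x: "x \<in> c00 k"
    and S: "\<And>s. s \<in> S \<Longrightarrow> s \<lhd> v \<and> length s = l \<and> T_norm k d \<theta> (restr (subtree k s) x) \<le> M"
    and supp: "\<And>w. x w \<noteq> 0 \<Longrightarrow> v \<lhd> w \<and> (\<exists>s\<in>S. w \<in> subtree k s)"
    and M: "0 \<le> M"
  shows "T_norm k d \<theta> x \<le> \<theta> * (real d - 1) / (1 - \<theta>) * M"
proof (rule T_norm_le)
  fix j
  define B where "B = \<theta> * (real d - 1) / (1 - \<theta>) * M"
  \<comment> \<open>The condition \<open>d * \<theta> > 1\<close> says exactly that the constant
    \<open>\<theta> * (d - 1) / (1 - \<theta>)\<close> exceeds 1.\<close>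
  have "1 * M \<le> \<theta> * (real d - 1) / (1 - \<theta>) * M"
    using d\<theta> \<theta>_less M by (intro mult_right_mono) (auto simp: field_simps)
  then have MB: "M \<le> B"
    by (simp add: B_def)
  have fix_B: "\<theta> * (B + (real d - 1) * M) = B"
    using \<theta>_less by (simp add: B_def field_simps)
  show "P j x \<le> \<theta> * (real d - 1) / (1 - \<theta>) * M"
    unfolding B_def[symmetric] using x S supp
  proof (induction j arbitrary: x)
    case (0 x)
    have "\<bar>x w\<bar> \<le> B" for w
    proof (cases "x w = 0")
      case True
      then show ?thesis using M MB by simp
    next
      case False
      then obtain s where s: "s \<in> S" "w \<in> subtree k s"
        using 0 by blast
      then have "\<bar>x w\<bar> = \<bar>restr (subtree k s) x w\<bar>"
        by (simp add: restr_def)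
      also have "\<dots> \<le> T_norm k d \<theta> (restr (subtree k s) x)"
        using 0 by (intro abs_le_T_norm restr_c00)
      finally show ?thesis
        using 0(2)[OF s(1)] MB by linarith
    qed
    then show ?case
      using pre_norm_0_le_iff[OF 0(1)] by blast
  next
    case (Suc j x)
    \<comment> \<open>The induction runs over all \<open>x\<close> because the hypotheses pass to
      restrictions: the components shrink, and so does the support.\<close>
    have restr_B: "P j (restr E x) \<le> B" for E
    proof (rule Suc.IH)
      show "restr E x \<in> c00 k"
        by (rule restr_c00) (rule Suc.prems)
      fix s assume s: "s \<in> S"
      have "T_norm k d \<theta> (restr (subtree k s) (restr E x)) \<le> T_norm k d \<theta> (restr (subtree k s) x)"
        using T_norm_restr_le[OF restr_c00[OF Suc.prems(1)]] by (simp add: restr_restr Int_commute)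
      then show "s \<lhd> v \<and> length s = l \<and> T_norm k d \<theta> (restr (subtree k s) (restr E x)) \<le> M"
        using Suc.prems(2)[OF s] by linarith
    next
      fix w assume "restr E x w \<noteq> 0"
      then show "v \<lhd> w \<and> (\<exists>s\<in>S. w \<in> subtree k s)"
        using Suc.prems(3) by (auto simp: restr_def split: if_splits)
    qed
    have "\<theta> * (\<Sum>E\<leftarrow>Es. P j (restr E x)) \<le> B" if "admissible k d Es" for Es
    proof -
      have "(\<Sum>E\<leftarrow>Es. P j (restr E x)) \<le> B + (real (length Es) - 1) * M"
        using that
        by (intro sum_list_pre_norm_le[OF Suc.prems M restr_B]) (auto simp: admissible_def)
      also have "\<dots> \<le> B + (real d - 1) * M"
        using that M by (intro add_left_mono mult_right_mono) (auto simp: admissible_def)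
      finally have "\<theta> * (\<Sum>E\<leftarrow>Es. P j (restr E x)) \<le> \<theta> * (B + (real d - 1) * M)"
        using \<theta>_pos by (intro mult_left_mono) auto
      then show ?thesis
        by (simp add: fix_B)
    qed
    moreover have "P j x \<le> B"
      using Suc by blast
    ultimately show ?case
      using pre_norm_Suc_le_iff[OF Suc.prems(1)] by blast
  qed
qed

end


section \<open>Coordinates in the completion\<close>

lemma has_sum_sum:
  fixes f :: "'i \<Rightarrow> 'a \<Rightarrow> 'b::topological_comm_monoid_add"
  assumes "\<And>i. i \<in> I \<Longrightarrow> (f i has_sum x i) A"
  shows "((\<lambda>v. \<Sum>i\<in>I. f i v) has_sum (\<Sum>i\<in>I. x i)) A"
  using assms by (induction I rule: infinite_finite_induct) (auto intro: has_sum_add)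

text \<open>The coefficients vanish off \<open>F\<close>, so that several such vectors can be
  expanded over one common finite set.\<close>

lemma span_image_finite_sum:
  fixes e :: "'a \<Rightarrow> 'b::real_vector"
  assumes "y \<in> span (e ` A)"
  shows "\<exists>a F. finite F \<and> F \<subseteq> A \<and> (\<forall>v. v \<notin> F \<longrightarrow> a v = 0) \<and> y = (\<Sum>v\<in>F. a v *\<^sub>R e v)"
  using assms
proof (induction rule: span_induct_alt)
  case base
  then show ?case
    by (intro exI[of _ "\<lambda>_. 0"] exI[of _ "{}"]) simp
next
  case (step c z y)
  then obtain u where u: "u \<in> A" "z = e u"
    by blast
  from step obtain a F where aF: "finite F" "F \<subseteq> A" "\<And>v. v \<notin> F \<Longrightarrow> a v = 0"
      "y = (\<Sum>v\<in>F. a v *\<^sub>R e v)"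
    by blast
  define b where "b v = a v + (if v = u then c else 0)" for v
  have "(\<Sum>v\<in>insert u F. b v *\<^sub>R e v) = (\<Sum>v\<in>insert u F. a v *\<^sub>R e v)
      + (\<Sum>v\<in>insert u F. if v = u then c *\<^sub>R e u else 0)"
    unfolding sum.distrib[symmetric] by (rule sum.cong) (auto simp: b_def scaleR_add_left)
  also have "(\<Sum>v\<in>insert u F. a v *\<^sub>R e v) = y"
    unfolding aF(4) by (rule sum.mono_neutral_right) (use aF in auto)
  also have "(\<Sum>v\<in>insert u F. if v = u then c *\<^sub>R e u else 0) = c *\<^sub>R z"
    using aF(1) u by simp
  finally have "c *\<^sub>R z + y = (\<Sum>v\<in>insert u F. b v *\<^sub>R e v)"
    by simp
  then show ?case
    using aF u by (intro exI[of _ b] exI[of _ "insert u F"]) (auto simp: b_def)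
qed

locale tree_space = tree_norm +
  fixes e :: "nat list \<Rightarrow> 'b::banach"
  assumes basis: "T_basis k d \<theta> e"
begin

lemma restr_finite_c00: "finite F \<Longrightarrow> F \<subseteq> nd_eq k \<Longrightarrow> restr F c \<in> c00 k"
  by (auto simp: c00_def restr_def elim: rev_finite_subset)

lemma norm_sum_basis:
  assumes "finite F" "F \<subseteq> nd_eq k"
  shows "norm (\<Sum>v\<in>F. c v *\<^sub>R e v) = T_norm k d \<theta> (restr F c)"
proof -
  have "(\<Sum>v\<in>F. c v *\<^sub>R e v) = (\<Sum>v | restr F c v \<noteq> 0. restr F c v *\<^sub>R e v)"
    using assms(1) by (intro sum.mono_neutral_cong_right) (auto simp: restr_def)
  then show ?thesis
    using basis restr_finite_c00[OF assms] by (simp add: T_basis_def)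
qed

text \<open>The form of unconditionality used below: dropping coordinates is a restriction, which
  does not increase \<open>T_norm\<close>.\<close>

lemma norm_sum_basis_mono:
  assumes "finite G" "G \<subseteq> nd_eq k" "F \<subseteq> G"
  shows "norm (\<Sum>v\<in>F. c v *\<^sub>R e v) \<le> norm (\<Sum>v\<in>G. c v *\<^sub>R e v)"
proof -
  have "finite F" "F \<subseteq> nd_eq k"
    using assms finite_subset by blast+
  moreover have "restr F c = restr F (restr G c)"
    using assms(3) by (simp add: restr_restr Int_absorb2)
  ultimately show ?thesis
    using T_norm_restr_le[OF restr_finite_c00[OF assms(1,2)], of F c] assms
    by (simp add: norm_sum_basis)
qed

lemma abs_le_norm_sum_basis:
  assumes "finite F" "F \<subseteq> nd_eq k" "v \<in> F"
  shows "\<bar>c v\<bar> \<le> norm (\<Sum>v\<in>F. c v *\<^sub>R e v)"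
  using abs_le_T_norm[OF restr_finite_c00[OF assms(1,2)], of c v] assms
  by (simp add: norm_sum_basis restr_def)

section \<open>Infinite expansions and their finite sections\<close>

text \<open>The norms of the finite sections increase along the net, so their limit
  \<open>norm x\<close> dominates each of them.\<close>

lemma norm_finite_section_le:
  assumes "((\<lambda>v. c v *\<^sub>R e v) has_sum x) (nd_eq k)" "finite F" "F \<subseteq> nd_eq k"
  shows "norm (\<Sum>v\<in>F. c v *\<^sub>R e v) \<le> norm x"
proof (rule tendsto_lowerbound)
  show "((\<lambda>G. norm (\<Sum>v\<in>G. c v *\<^sub>R e v)) \<longlongrightarrow> norm x) (finite_subsets_at_top (nd_eq k))"
    using assms(1) unfolding has_sum_def by (rule tendsto_norm)
  show "\<forall>\<^sub>F G in finite_subsets_at_top (nd_eq k).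
      norm (\<Sum>v\<in>F. c v *\<^sub>R e v) \<le> norm (\<Sum>v\<in>G. c v *\<^sub>R e v)"
    unfolding eventually_finite_subsets_at_top
    using assms norm_sum_basis_mono by (intro exI[of _ F]) simp
qed simp

lemma norm_le_of_finite_sections:
  assumes "((\<lambda>v. c v *\<^sub>R e v) has_sum x) (nd_eq k)"
    and "\<And>F. finite F \<Longrightarrow> F \<subseteq> nd_eq k \<Longrightarrow> norm (\<Sum>v\<in>F. c v *\<^sub>R e v) \<le> B"
  shows "norm x \<le> B"
proof (rule tendsto_upperbound)
  show "((\<lambda>G. norm (\<Sum>v\<in>G. c v *\<^sub>R e v)) \<longlongrightarrow> norm x) (finite_subsets_at_top (nd_eq k))"
    using assms(1) unfolding has_sum_def by (rule tendsto_norm)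
  show "\<forall>\<^sub>F G in finite_subsets_at_top (nd_eq k). norm (\<Sum>v\<in>G. c v *\<^sub>R e v) \<le> B"
    unfolding eventually_finite_subsets_at_top
    using assms(2) by blast
qed simp

text \<open>The difference of the two expansions represents 0, and each of its one-coordinate
  sections has norm at most \<open>norm 0\<close>.\<close>

lemma expansion_unique:
  assumes "((\<lambda>v. c v *\<^sub>R e v) has_sum x) (nd_eq k)" "((\<lambda>v. c' v *\<^sub>R e v) has_sum x) (nd_eq k)"
    and v: "v \<in> nd_eq k"
  shows "c v = c' v"
proof -
  have "((\<lambda>v. (c v - c' v) *\<^sub>R e v) has_sum (x - x)) (nd_eq k)"
    using has_sum_add[OF assms(1), of "\<lambda>v. - (c' v *\<^sub>R e v)" "- x"] assms(2)
    by (simp add: scaleR_diff_left has_sum_uminus)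
  then have "norm (\<Sum>v\<in>{v}. (c v - c' v) *\<^sub>R e v) \<le> norm (x - x)"
    using v by (intro norm_finite_section_le) auto
  then show ?thesis
    using abs_le_norm_sum_basis[of "{v}" v "\<lambda>v. c v - c' v"] v by simp
qed

text \<open>Gives the definite description in \<open>coords\<close> its meaning and computes it from
  any expansion.\<close>

lemma coords_eqI:
  assumes "\<And>v. v \<notin> nd_eq k \<Longrightarrow> c v = 0" "((\<lambda>v. c v *\<^sub>R e v) has_sum x) (nd_eq k)"
  shows "coords k e x = c"
  unfolding coords_def
proof (rule the_equality)
  fix c' assume "(\<forall>v. v \<notin> nd_eq k \<longrightarrow> c' v = 0) \<and> ((\<lambda>v. c' v *\<^sub>R e v) has_sum x) (nd_eq k)"
  then show "c' = c"
    using assms expansion_unique[of c' x c] by (intro ext) metis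
qed (use assms in auto)

text \<open>The coefficients of approximating finite sums converge coordinatewise, and the limits
  expand \<open>x\<close>. Keeping track of \<open>A\<close> shows that vectors in
  \<open>T_sub k e s\<close> have coefficients only on the subtree of \<open>s\<close>.\<close>

lemma expansion_exists:
  assumes A: "A \<subseteq> nd_eq k" and x: "x \<in> closure (span (e ` A))"
  obtains c where "\<And>v. v \<notin> A \<Longrightarrow> c v = 0" "((\<lambda>v. c v *\<^sub>R e v) has_sum x) (nd_eq k)"
proof -
  obtain y where y: "\<And>n. y n \<in> span (e ` A)" "y \<longlonglongrightarrow> x"
    using closure_sequential[THEN iffD1, OF x] by metis
  have "\<exists>a F. finite F \<and> F \<subseteq> A \<and> (\<forall>v. v \<notin> F \<longrightarrow> a v = 0) \<and> y n = (\<Sum>v\<in>F. a v *\<^sub>R e v)" for n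
    using span_image_finite_sum[OF y(1)] .
  then obtain a F where aF: "\<And>n. finite (F n)" "\<And>n. F n \<subseteq> A" "\<And>n v. v \<notin> F n \<Longrightarrow> a n v = 0"
      "\<And>n. y n = (\<Sum>v\<in>F n. a n v *\<^sub>R e v)"
    by metis
  have y_sum: "y n = (\<Sum>v\<in>G. a n v *\<^sub>R e v)" if "finite G" "F n \<subseteq> G" for n G
    unfolding aF(4) by (rule sum.mono_neutral_left) (use that aF(3) in auto)
  have diff: "norm (\<Sum>v\<in>G. (a n v - a m v) *\<^sub>R e v) \<le> norm (y n - y m)"
    if "finite G" "G \<subseteq> nd_eq k" for G n m
  proof -
    \<comment> \<open>Over \<open>?H\<close> both vectors are fully expanded, so the section over
      \<open>G\<close> drops coordinates of \<open>y n - y m\<close>.\<close>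
    let ?H = "G \<union> F n \<union> F m"
    have H: "finite ?H" "?H \<subseteq> nd_eq k"
      using that aF(1) subset_trans[OF aF(2) A] by auto
    have "y n - y m = (\<Sum>v\<in>?H. (a n v - a m v) *\<^sub>R e v)"
      using y_sum[OF H(1), of n] y_sum[OF H(1), of m] by (auto simp: scaleR_diff_left sum_subtractf)
    then show ?thesis
      using norm_sum_basis_mono[OF H, of G "\<lambda>v. a n v - a m v"] by auto
  qed
  have "\<exists>l. (\<lambda>n. a n v) \<longlonglongrightarrow> l" for v
  proof (cases "v \<in> A")
    case True
    \<comment> \<open>Single coordinates are bounded by the norm, so they inherit the Cauchy
      property of \<open>y\<close>.\<close>
    have "Cauchy (\<lambda>n. a n v)"
    proof (rule metric_CauchyI)
      fix \<epsilon> :: real assume "0 < \<epsilon>"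
      then obtain M where M: "\<And>m n. m \<ge> M \<Longrightarrow> n \<ge> M \<Longrightarrow> dist (y m) (y n) < \<epsilon>"
        using metric_CauchyD[OF LIMSEQ_imp_Cauchy[OF y(2)]] by metis
      have "dist (a m v) (a n v) \<le> dist (y m) (y n)" for m n
        using diff[of "{v}" m n] abs_le_norm_sum_basis[of "{v}" v "\<lambda>v. a m v - a n v"] True A
        by (auto simp: dist_norm)
      then show "\<exists>M. \<forall>m\<ge>M. \<forall>n\<ge>M. dist (a m v) (a n v) < \<epsilon>"
        using M order_le_less_trans by blast
    qed
    then show ?thesis
      using real_Cauchy_convergent convergent_def by blast
  next
    case False
    then have "a n v = 0" for n
      using aF(2,3) by blast
    then show ?thesis
      by auto
  qed
  then obtain c where c: "\<And>v. (\<lambda>n. a n v) \<longlonglongrightarrow> c v"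
    by metis
  have c0: "c v = 0" if "v \<notin> A" for v
  proof -
    have "a n v = 0" for n
      using aF(2,3) that by blast
    then show ?thesis
      using c[of v] by (simp add: LIMSEQ_const_iff)
  qed
  \<comment> \<open>Let \<open>m\<close> tend to infinity in \<open>diff\<close>. The bound is
    uniform in \<open>G\<close>, which gives convergence of the whole net.\<close>
  have lim: "norm (\<Sum>v\<in>G. (a n v - c v) *\<^sub>R e v) \<le> norm (y n - x)"
    if "finite G" "G \<subseteq> nd_eq k" for G n
  proof (rule LIMSEQ_le)
    show "(\<lambda>m. norm (\<Sum>v\<in>G. (a n v - a m v) *\<^sub>R e v)) \<longlonglongrightarrow> norm (\<Sum>v\<in>G. (a n v - c v) *\<^sub>R e v)"
      by (intro tendsto_intros c)
    show "(\<lambda>m. norm (y n - y m)) \<longlonglongrightarrow> norm (y n - x)"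
      by (intro tendsto_intros y)
  qed (use diff that in auto)
  have "((\<lambda>v. c v *\<^sub>R e v) has_sum x) (nd_eq k)"
    unfolding has_sum_def
  proof (rule tendstoI)
    fix \<epsilon> :: real assume "0 < \<epsilon>"
    then obtain n where n: "norm (y n - x) < \<epsilon> / 2"
      using metric_LIMSEQ_D[OF y(2), of "\<epsilon> / 2"] by (auto simp: dist_norm)
    have "dist (\<Sum>v\<in>G. c v *\<^sub>R e v) x < \<epsilon>" if G: "finite G" "F n \<subseteq> G" "G \<subseteq> nd_eq k" for G
    proof -
      have "(\<Sum>v\<in>G. (a n v - c v) *\<^sub>R e v) = y n - (\<Sum>v\<in>G. c v *\<^sub>R e v)"
        using y_sum[OF G(1,2)] by (simp add: scaleR_diff_left sum_subtractf)
      then have "norm (y n - (\<Sum>v\<in>G. c v *\<^sub>R e v)) < \<epsilon> / 2"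
        using lim[OF G(1,3), of n] n by simp
      then show ?thesis
        using n dist_triangle_half_r[of "y n" _ \<epsilon> x] by (simp add: dist_norm)
    qed
    then show "\<forall>\<^sub>F G in finite_subsets_at_top (nd_eq k). dist (\<Sum>v\<in>G. c v *\<^sub>R e v) x < \<epsilon>"
      unfolding eventually_finite_subsets_at_top
      using aF(1) subset_trans[OF aF(2) A] by (intro exI[of _ "F n"]) simp
  qed
  then show ?thesis
    using that c0 by blast
qed


section \<open>Tree sums\<close>

text \<open>Transfers both estimates to infinite expansions. Subtrees of distinct nodes of equal
  length are disjoint, so each summand is the part of the total expansion on its own
  subtree.\<close>

lemma tree_sum_bounds:
  assumes d\<theta>: "real d * \<theta> > 1" and I: "finite I" "I \<noteq> {}"
    and s: "inj_on s I" "\<And>i. i \<in> I \<Longrightarrow> s i \<lhd> v \<and> length (s i) = l"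
    and c: "\<And>i. i \<in> I \<Longrightarrow> ((\<lambda>w. c i w *\<^sub>R e w) has_sum xs i) (nd_eq k)"
    and supp: "\<And>i w. i \<in> I \<Longrightarrow> c i w \<noteq> 0 \<Longrightarrow> v \<lhd> w \<and> w \<in> subtree k (s i)"
  shows "(MAX i\<in>I. norm (xs i)) \<le> norm (\<Sum>i\<in>I. xs i)"
    and "norm (\<Sum>i\<in>I. xs i) \<le> \<theta> * (real d - 1) / (1 - \<theta>) * (MAX i\<in>I. norm (xs i))"
proof -
  define b where "b w = (\<Sum>i\<in>I. c i w)" for w
  have b_sum: "((\<lambda>w. b w *\<^sub>R e w) has_sum (\<Sum>i\<in>I. xs i)) (nd_eq k)"
    using has_sum_sum[OF c] by (simp add: b_def scaleR_sum_left)
  have b_eq: "b w = c i w" if "i \<in> I" "w \<in> subtree k (s i)" for i w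
  proof -
    have "c j w = 0" if j: "j \<in> I" "j \<noteq> i" for j
    proof (rule ccontr)
      assume "c j w \<noteq> 0"
      then have "prefix (s j) w" "prefix (s i) w"
        using supp[of j w] j \<open>w \<in> subtree k (s i)\<close> by (auto simp: subtree_def)
      then have "s j = s i"
        using s(2) j \<open>i \<in> I\<close> by (metis prefix_length_prefix prefix_order.antisym order_refl)
      then show False
        using s(1) j \<open>i \<in> I\<close> by (auto dest: inj_onD)
    qed
    then have "(\<Sum>j\<in>I - {i}. c j w) = 0"
      by (intro sum.neutral) auto
    then show ?thesis
      using I(1) that(1) by (simp add: b_def sum.remove)
  qed
  have c_eq: "c i w = restr (subtree k (s i)) b w" if "i \<in> I" for i w
    using b_eq supp that by (auto simp: restr_def)
  \<comment> \<open>A finite section of a summand is thus a finite section of the total sum, which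
    yields the lower bound.\<close>
  have section_eq: "(\<Sum>w\<in>F. c i w *\<^sub>R e w) = (\<Sum>w\<in>F \<inter> subtree k (s i). b w *\<^sub>R e w)"
    if "i \<in> I" "finite F" for i F
    using that by (simp add: c_eq restr_def sum.inter_restrict if_distribR cong: if_cong)
      (intro sum.cong; simp)
  have "norm (xs i) \<le> norm (\<Sum>i\<in>I. xs i)" if "i \<in> I" for i
  proof (rule norm_le_of_finite_sections[OF c[OF that]])
    fix F assume "finite F" "F \<subseteq> nd_eq k"
    then show "norm (\<Sum>w\<in>F. c i w *\<^sub>R e w) \<le> norm (\<Sum>i\<in>I. xs i)"
      using norm_finite_section_le[OF b_sum, of "F \<inter> subtree k (s i)"] section_eq that by auto
  qed
  then show "(MAX i\<in>I. norm (xs i)) \<le> norm (\<Sum>i\<in>I. xs i)"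
    using I by simp
  define M where "M = (MAX i\<in>I. norm (xs i))"
  have M: "norm (xs i) \<le> M" if "i \<in> I" for i
    using I that by (simp add: M_def)
  have M0: "0 \<le> M"
    using M I(2) norm_ge_zero order_trans by blast
  show "norm (\<Sum>i\<in>I. xs i) \<le> \<theta> * (real d - 1) / (1 - \<theta>) * (MAX i\<in>I. norm (xs i))"
    unfolding M_def[symmetric]
  proof (rule norm_le_of_finite_sections[OF b_sum])
    fix F assume F: "finite F" "F \<subseteq> nd_eq k"
    have "T_norm k d \<theta> (restr F b) \<le> \<theta> * (real d - 1) / (1 - \<theta>) * M"
    proof (rule T_norm_tree_sum_le[OF d\<theta> restr_finite_c00[OF F] _ _ M0])
      fix r assume "r \<in> s ` I"
      then obtain i where i: "i \<in> I" "r = s i"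
        by blast
      \<comment> \<open>This identifies the component of the section on one subtree with a section
        of \<open>xs i\<close>, whose norm is at most \<open>norm (xs i)\<close>.\<close>
      have "restr (subtree k r) (restr F b) = restr F (c i)"
        using c_eq i by (auto simp: restr_def)
      then have "T_norm k d \<theta> (restr (subtree k r) (restr F b)) \<le> norm (xs i)"
        using norm_finite_section_le[OF c[OF i(1)] F] by (simp add: norm_sum_basis[OF F])
      then show "r \<lhd> v \<and> length r = l \<and> T_norm k d \<theta> (restr (subtree k r) (restr F b)) \<le> M"
        using M[OF i(1)] s(2)[OF i(1)] i(2) by simp
    next
      fix w assume "restr F b w \<noteq> 0"
      then have "b w \<noteq> 0"
        by (auto simp: restr_def split: if_splits)
      then obtain i where "i \<in> I" "c i w \<noteq> 0"
        unfolding b_def by (metis sum.neutral)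
      then show "v \<lhd> w \<and> (\<exists>r\<in>s ` I. w \<in> subtree k r)"
        using supp by blast
    qed
    then show "norm (\<Sum>w\<in>F. b w *\<^sub>R e w) \<le> \<theta> * (real d - 1) / (1 - \<theta>) * M"
      by (simp add: norm_sum_basis[OF F])
  qed
qed

end

section \<open>The canonical isomorphism with the sup-norm space and the main result\<close>

text \<open>Two-sided estimates with \<open>A = 1\<close> and \<open>B = C\<close> suffice: the
  lower one, applied to differences, gives injectivity, and the image of \<open>linf N\<close> is a
  subspace containing every \<open>y i\<close>.\<close>

lemma canonically_linfI:
  fixes y :: "nat \<Rightarrow> 'b::real_normed_vector"
  assumes N: "N \<ge> 1" and C: "C > 0"
    and low: "\<And>a. linf_norm N a \<le> norm (\<Sum>i=1..N. a i *\<^sub>R y i)"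
    and up: "\<And>a. norm (\<Sum>i=1..N. a i *\<^sub>R y i) \<le> C * linf_norm N a"
  shows "canonically_linf C N y"
proof -
  let ?J = "\<lambda>a. \<Sum>i=1..N. a i *\<^sub>R y i"
  have "inj_on ?J (linf N)"
  proof (rule inj_onI)
    fix a b assume ab: "a \<in> linf N" "b \<in> linf N" "?J a = ?J b"
    have "?J (\<lambda>i. a i - b i) = 0"
      using ab(3) by (simp add: scaleR_diff_left sum_subtractf)
    then have "linf_norm N (\<lambda>i. a i - b i) \<le> 0"
      using low[of "\<lambda>i. a i - b i"] by simp
    then have "a i = b i" if "i \<in> {1..N}" for i
      using that N by (auto simp: linf_norm_def)
    then show "a = b"
      using ab(1,2) unfolding linf_def by (intro ext) (metis (mono_tags, lifting) mem_Collect_eq)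
  qed
  moreover have "?J ` linf N = span (y ` {1..N})"
  proof
    show "?J ` linf N \<subseteq> span (y ` {1..N})"
      by (auto intro!: span_sum span_scale intro: span_base)
    have lin: "subspace (?J ` linf N)"
    proof (rule subspaceI)
      show "0 \<in> ?J ` linf N"
        by (rule image_eqI[of _ _ "\<lambda>_. 0"]) (auto simp: linf_def)
    next
      fix p q assume "p \<in> ?J ` linf N" "q \<in> ?J ` linf N"
      then obtain a b where "a \<in> linf N" "b \<in> linf N" "p = ?J a" "q = ?J b"
        by blast
      then show "p + q \<in> ?J ` linf N"
        by (intro image_eqI[of _ _ "\<lambda>i. a i + b i"])
          (auto simp: linf_def scaleR_add_left sum.distrib)
    next
      fix r p assume "p \<in> ?J ` linf N"
      then obtain a where "a \<in> linf N" "p = ?J a"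
        by blast
      then show "r *\<^sub>R p \<in> ?J ` linf N"
        by (intro image_eqI[of _ _ "\<lambda>i. r * a i"]) (auto simp: linf_def scaleR_sum_right)
    qed
    have "y i \<in> ?J ` linf N" if "i \<in> {1..N}" for i
    proof (rule image_eqI)
      have "?J (\<lambda>j. if j = i then 1 else 0) = (\<Sum>j=1..N. if j = i then y j else 0)"
        by (rule sum.cong) auto
      then show "y i = ?J (\<lambda>j. if j = i then 1 else 0)"
        using that by simp
    qed (use that in \<open>auto simp: linf_def\<close>)
    then show "span (y ` {1..N}) \<subseteq> ?J ` linf N"
      by (intro span_minimal lin) auto
  qed
  ultimately have "bij_betw ?J (linf N) (span (y ` {1..N}))"
    by (simp add: bij_betw_def)
  then show ?thesis
    unfolding canonically_linf_def
    using C low up by (intro conjI exI[of _ 1] exI[of _ C]) auto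
qed

text \<open>Quantifying \<open>C\<close> before \<open>N\<close> and the vectors expresses its
  independence of them; the witness is the constant of the upper estimate.\<close>

theorem theorem4p4:
  fixes k d :: nat and \<theta> :: real and e :: "nat list \<Rightarrow> 'b::banach"
  assumes "k \<ge> 2" and "d \<ge> 1" and "0 < \<theta>" and "\<theta> < 1" and "real d * \<theta> > 1"
    and "T_basis k d \<theta> e"
  shows "\<exists>C. \<forall>(N::nat) (s :: nat \<Rightarrow> nat list) l v x xs.
     N \<ge> 1 \<and>
     (\<forall>i\<in>{1..N}. s i \<in> nd_le k) \<and>
     (\<forall>i\<in>{1..N}. \<forall>j\<in>{1..N}. i < j \<longrightarrow> s i \<lhd> s j) \<and>
     (\<forall>i\<in>{1..N}. length (s i) = l) \<and> l < k \<and>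
     v \<in> nd_eq k \<and> s N \<lhd> v \<and>
     x \<in> T_space k e \<and> (\<forall>w\<in>supp k e x. v \<lhd> w) \<and>
     (\<forall>i\<in>{1..N}. xs i \<in> T_sub k e (s i)) \<and> x = (\<Sum>i=1..N. xs i)
     \<longrightarrow>
       (MAX i\<in>{1..N}. norm (xs i)) \<le> norm x \<and>
       norm x \<le> \<theta> * (real d - 1) / (1 - \<theta>) * (MAX i\<in>{1..N}. norm (xs i)) \<and>
       ((\<forall>i\<in>{1..N}. norm (xs i) = 1) \<longrightarrow> canonically_linf C N xs)"
proof (intro exI[of _ "\<theta> * (real d - 1) / (1 - \<theta>)"] allI impI, elim conjE)
  fix N :: nat and s :: "nat \<Rightarrow> nat list" and l v x and xs :: "nat \<Rightarrow> 'b"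
  assume N: "N \<ge> 1" and s_mono: "\<forall>i\<in>{1..N}. \<forall>j\<in>{1..N}. i < j \<longrightarrow> s i \<lhd> s j"
    and len: "\<forall>i\<in>{1..N}. length (s i) = l" and sN: "s N \<lhd> v"
    and supp: "\<forall>w\<in>supp k e x. v \<lhd> w"
    and xs: "\<forall>i\<in>{1..N}. xs i \<in> T_sub k e (s i)" and x: "x = (\<Sum>i=1..N. xs i)"
  interpret tree_space k d \<theta> e
    using assms by unfold_locales auto
  let ?C = "\<theta> * (real d - 1) / (1 - \<theta>)"
  have "\<exists>c. (\<forall>w. w \<notin> subtree k (s i) \<longrightarrow> c w = 0) \<and> ((\<lambda>w. c w *\<^sub>R e w) has_sum xs i) (nd_eq k)"
    if i: "i \<in> {1..N}" for i
  proof (rule expansion_exists)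
    show "subtree k (s i) \<subseteq> nd_eq k"
      by (auto simp: subtree_def)
    show "xs i \<in> closure (span (e ` subtree k (s i)))"
      using xs i by (simp add: T_sub_def)
  qed blast
  then obtain c where c0: "\<And>i w. i \<in> {1..N} \<Longrightarrow> w \<notin> subtree k (s i) \<Longrightarrow> c i w = 0"
    and c: "\<And>i. i \<in> {1..N} \<Longrightarrow> ((\<lambda>w. c i w *\<^sub>R e w) has_sum xs i) (nd_eq k)"
    by metis
  have inj: "inj_on s {1..N}"
  proof (rule linorder_inj_onI)
    show "s i \<noteq> s j" if "i < j" "i \<in> {1..N}" "j \<in> {1..N}" for i j
      using s_mono that tprec_irrefl by metis
  qed auto
  have s: "s i \<lhd> v \<and> length (s i) = l" if i: "i \<in> {1..N}" for i
  proof (cases "i = N")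
    case False
    then have "s i \<lhd> s N"
      using s_mono i N by simp
    then show ?thesis
      using tprec_trans sN len i by blast
  qed (use sN len i in simp)
  \<comment> \<open>The support hypothesis concerns \<open>x\<close> only. It passes to the summands
    because, on the subtree of \<open>s i\<close>, the coordinates of \<open>x\<close> are those of
    \<open>xs i\<close>.\<close>
  have supp_c: "v \<lhd> w \<and> w \<in> subtree k (s i)" if i: "i \<in> {1..N}" and w: "c i w \<noteq> 0" for i w
  proof -
    have wi: "w \<in> subtree k (s i)"
      using c0 i w by blast
    have "c j w = 0" if j: "j \<in> {1..N}" "j \<noteq> i" for j
    proof (rule ccontr)
      assume "c j w \<noteq> 0"
      then have "w \<in> subtree k (s j)"
        using c0 j by blast
      then have "prefix (s j) w" "prefix (s i) w" "length (s j) = length (s i)"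
        using wi len i j by (simp_all add: subtree_def)
      then have "s j = s i"
        by (metis prefix_length_prefix prefix_order.antisym order_refl)
      then show False
        using inj i j by (auto dest: inj_onD)
    qed
    then have "(\<Sum>j\<in>{1..N} - {i}. c j w) = 0"
      by (intro sum.neutral) auto
    then have "(\<Sum>j\<in>{1..N}. c j w) = c i w"
      using i by (subst sum.remove[of _ i]) auto
    moreover have "coords k e x = (\<lambda>w. \<Sum>j\<in>{1..N}. c j w)"
    proof (rule coords_eqI)
      show "(\<Sum>j\<in>{1..N}. c j w) = 0" if "w \<notin> nd_eq k" for w
        using that c0 by (intro sum.neutral) (auto simp: subtree_def)
      show "((\<lambda>w. (\<Sum>j\<in>{1..N}. c j w) *\<^sub>R e w) has_sum x) (nd_eq k)"
        using has_sum_sum[of "{1..N}" "\<lambda>i w. c i w *\<^sub>R e w", OF c]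
        by (simp add: x scaleR_sum_left)
    qed
    ultimately show ?thesis
      using supp wi w by (simp add: supp_def)
  qed
  \<comment> \<open>Scalar multiples of the \<open>xs i\<close> satisfy the same support conditions.
    All \<open>a i = 1\<close> gives the norm estimates, arbitrary \<open>a\<close> the
    isomorphism.\<close>
  have bounds: "(MAX i\<in>{1..N}. norm (a i *\<^sub>R xs i)) \<le> norm (\<Sum>i=1..N. a i *\<^sub>R xs i)"
      "norm (\<Sum>i=1..N. a i *\<^sub>R xs i) \<le> ?C * (MAX i\<in>{1..N}. norm (a i *\<^sub>R xs i))" for a
  proof -
    have a: "((\<lambda>w. (a i * c i w) *\<^sub>R e w) has_sum a i *\<^sub>R xs i) (nd_eq k)" if "i \<in> {1..N}" for i
      using has_sum_scaleR[OF c[OF that], of "a i"] by simp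
    have supp_a: "v \<lhd> w \<and> w \<in> subtree k (s i)" if "i \<in> {1..N}" "a i * c i w \<noteq> 0" for i w
      using supp_c that by simp
    have ne: "{1..N} \<noteq> {}"
      using N by simp
    show "(MAX i\<in>{1..N}. norm (a i *\<^sub>R xs i)) \<le> norm (\<Sum>i=1..N. a i *\<^sub>R xs i)"
      by (rule tree_sum_bounds(1)[OF assms(5) finite_atLeastAtMost ne inj s a supp_a])
    show "norm (\<Sum>i=1..N. a i *\<^sub>R xs i) \<le> ?C * (MAX i\<in>{1..N}. norm (a i *\<^sub>R xs i))"
      by (rule tree_sum_bounds(2)[OF assms(5) finite_atLeastAtMost ne inj s a supp_a])
  qed
  have "canonically_linf ?C N xs" if norm1: "\<forall>i\<in>{1..N}. norm (xs i) = 1"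
  proof (rule canonically_linfI[OF N])
    \<comment> \<open>With \<open>\<theta> < 1\<close> and \<open>d * \<theta> > 1\<close> this
      forces \<open>d > 1\<close>, so the constant is positive.\<close>
    have "real d * \<theta> \<le> real d * 1"
      using assms(4) by (intro mult_left_mono) auto
    then have "real d > 1"
      using assms(5) by linarith
    then show "?C > 0"
      using assms(3,4) by simp
    have "(MAX i\<in>{1..N}. norm (a i *\<^sub>R xs i)) = linf_norm N a" for a
      unfolding linf_norm_def using norm1 by (intro arg_cong[of _ _ Max] image_cong) auto
    then show "linf_norm N a \<le> norm (\<Sum>i=1..N. a i *\<^sub>R xs i)"
      "norm (\<Sum>i=1..N. a i *\<^sub>R xs i) \<le> ?C * linf_norm N a" for a
      using bounds[of a] by auto
  qed
  then show "(MAX i\<in>{1..N}. norm (xs i)) \<le> norm x \<and>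
       norm x \<le> ?C * (MAX i\<in>{1..N}. norm (xs i)) \<and>
       ((\<forall>i\<in>{1..N}. norm (xs i) = 1) \<longrightarrow> canonically_linf ?C N xs)"
    using bounds[of "\<lambda>_. 1"] by (simp add: x)
qed

end
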